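(* For a positive integer $n$, let $f(n)$ be the maximum, over all unit interval graphs $G$ with $n$ vertices, of the minimum number of spanning trees of $G$ needed to collectively $+1$-span $G$. Then $f(n)=\Omega(\sqrt[3]{\log n})$.
   Context: All graphs are connected, finite, undirected, loopless and without multiple edges; $\mathrm{dist}_G(u,v)$ is the number of edges of a shortest path between $u$ and $v$ in $G$. A set $\mathcal{T}$ of spanning trees of a graph $G$ collectively $+1$-spans $G$ if for any two vertices $u,v$ of $G$ there is a tree $T\in\mathcal{T}$ with $\mathrm{dist}_T(u,v)\le \mathrm{dist}_G(u,v)+1$. A graph is a unit interval graph if one can associate with each vertex an interval on the real line, all intervals having the same length, such that two vertices are adjacent if and only if the corresponding intervals intersect. *)

theory Defs
  imports
    Complex_Main
    "HOL-Library.Landau_Symbols"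
    "Graph_Theory.Digraph_Component"
    "Graph_Theory.Shortest_Path"
begin

text \<open>
  A finite simple undirected graph is a symmetric pair digraph (\<^locale>\<open>pair_graph\<close>): the edge
  \<open>uv\<close> is the pair of arcs \<open>(u,v)\<close>, \<open>(v,u)\<close>. Being a record of a vertex set and a set of
  arcs, it has no multiple edges. Connectedness as defined in Digraph_Component implies that the vertex set is
  nonempty.
\<close>

definition simple_connected_graph :: "'a pair_pre_digraph \<Rightarrow> bool" where
  "simple_connected_graph G \<longleftrightarrow> pair_graph G \<and> Digraph_Component.connected G"

text \<open>
  In a symmetric digraph the closed walk \<open>u, v, u\<close> is a \<open>pre_digraph.cycle\<close>, so the constants
  \<open>tree\<close> and \<open>spanning_tree\<close> of Digraph_Component are not the undirected notions. The cycles of the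
  undirected graph are exactly the digraph cycles with at least three arcs.
\<close>

definition undirected_tree :: "'a pair_pre_digraph \<Rightarrow> bool" where
  "undirected_tree T \<longleftrightarrow> simple_connected_graph T \<and>
     \<not> (\<exists>p. pre_digraph.cycle T p \<and> 3 \<le> length p)"

definition undirected_spanning_tree :: "'a pair_pre_digraph \<Rightarrow> 'a pair_pre_digraph \<Rightarrow> bool" where
  "undirected_spanning_tree T G \<longleftrightarrow> undirected_tree T \<and> spanning T G"

definition graph_dist :: "'a pair_pre_digraph \<Rightarrow> 'a \<Rightarrow> 'a \<Rightarrow> ereal" where
  "graph_dist G u v = wf_digraph.\<mu> G (\<lambda>_. 1) u v"

text \<open>With unit weights, \<open>\<mu>\<close> is the number of edges of a shortest path.\<close>

lemma graph_dist_shortest_path: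
  assumes "simple_connected_graph G" "u \<in> pverts G" "v \<in> pverts G"
  shows "\<exists>p. pre_digraph.apath G u p v \<and> graph_dist G u v = ereal (real (length p)) \<and>
    (\<forall>q. pre_digraph.apath G u q v \<longrightarrow> length p \<le> length q)"
proof -
  interpret pair_graph G
    using assms(1) by (simp add: simple_connected_graph_def)
  have len: "awalk_cost (\<lambda>_. 1) q = real (length q)" for q
    by (induct q) auto
  have "u \<rightarrow>\<^sup>*\<^bsub>mk_symmetric G\<^esub> v"
    using assms
    by (auto simp: simple_connected_graph_def Digraph_Component.connected_def strongly_connected_def)
  then have "u \<rightarrow>\<^sup>*\<^bsub>with_proj G\<^esub> v"
    by (simp add: reachable_mk_symmetric_eq[OF sym_arcs])
  from min_cost_awalk[OF this, of "\<lambda>_. 1"] obtain p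
    where "apath u p v" "graph_dist G u v = ereal (real (length p))"
    by (auto simp: graph_dist_def len)
  moreover have "length p \<le> length q" if "apath u q v" for q
    using min_cost_le_walk_cost[of u q v "\<lambda>_. 1"] that calculation
    by (simp add: graph_dist_def len apath_def)
  ultimately show ?thesis by blast
qed

definition collectively_plus_one_spans ::
    "'a pair_pre_digraph set \<Rightarrow> 'a pair_pre_digraph \<Rightarrow> bool" where
  "collectively_plus_one_spans \<T> G \<longleftrightarrow>
     (\<forall>T\<in>\<T>. undirected_spanning_tree T G) \<and>
     (\<forall>u\<in>pverts G. \<forall>v\<in>pverts G. \<exists>T\<in>\<T>. graph_dist T u v \<le> graph_dist G u v + 1)"

text \<open>
  Intervals are closed and of positive length; distinct vertices may share an interval.
\<close>

definition unit_interval_graph :: "'a pair_pre_digraph \<Rightarrow> bool" where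
  "unit_interval_graph G \<longleftrightarrow> simple_connected_graph G \<and>
     (\<exists>(len::real) (left :: 'a \<Rightarrow> real). 0 < len \<and>
       (\<forall>u\<in>pverts G. \<forall>v\<in>pverts G. u \<noteq> v \<longrightarrow>
          ((u, v) \<in> parcs G \<longleftrightarrow>
           {left u .. left u + len} \<inter> {left v .. left v + len} \<noteq> {})))"

definition plus_one_tree_number :: "'a pair_pre_digraph \<Rightarrow> nat" where
  "plus_one_tree_number G =
     (LEAST k. \<exists>\<T>. finite \<T> \<and> card \<T> = k \<and> collectively_plus_one_spans \<T> G)"

text \<open>
  Vertices are natural numbers: up to isomorphism this covers all finite graphs. The maximum is
  over a finite set of numbers, as the tree number is at most the number of spanning trees.
\<close>

definition max_plus_one_tree_number :: "nat \<Rightarrow> nat" where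
  "max_plus_one_tree_number n =
     Max {plus_one_tree_number G | G :: nat pair_pre_digraph.
            unit_interval_graph G \<and> card (pverts G) = n}"

end

theory Submission
  imports Defs "HOL-Library.FuncSet"
begin

text \<open>
  The graph is the \<open>m\<close>-th power of a path, with \<open>N = 4 ^ k + 1\<close> test vertices
  \<open>x i = i * m + r i\<close>, where \<open>r\<close> is decreasing; so \<open>x i\<close> and \<open>x j\<close> are at distance \<open>j - i\<close>.
  A walk in a tree from \<open>x i\<close> to \<open>x l\<close> with at most \<open>l - i + 2\<close> edges visits so few vertices that, for a
  generic choice of the offsets, it misses every \<open>x j\<close> with \<open>i < j < l\<close>, in each of \<open>k\<close> given trees.
  Hence if a tree serves both \<open>(x i, x j)\<close> and \<open>(x j, x l)\<close>, the two tree paths share their edge at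
  \<open>x j\<close>. So all paths served at \<open>x j\<close>, incoming and outgoing, use one and the same edge there. The vertices
  without incoming paths, those without outgoing paths, those whose edge leads to the right and
  those whose edge leads to the left each form an independent set of the graph of served pairs: in
  the last two cases a path between two vertices of the class would have to cover more ground than
  its length allows. Thus each tree yields a 4-colouring of the \<open>x i\<close>, and \<open>k\<close> trees cannot
  separate \<open>4 ^ k + 1\<close> vertices. Since \<open>m\<close> may be taken exponential in \<open>k\<close>, this
  even gives \<open>\<Omega>(ln n)\<close>.
\<close>

section \<open>Colouring the pairs served by one tree\<close>

lemma relpow_le_add_mult:
  fixes m :: nat
  assumes "(a, b) \<in> E ^^ n" "\<And>a b. (a, b) \<in> E \<Longrightarrow> b \<le> a + m"
  shows "b \<le> a + m * n"
  using assms(1)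
proof (induction n arbitrary: b)
  case (Suc n)
  then obtain c where "(a, c) \<in> E ^^ n" "(c, b) \<in> E" by auto
  with Suc.IH assms(2) have "c \<le> a + m * n" "b \<le> c + m" by blast+
  then show ?case by simp
qed simp

text \<open>
  A path from \<open>u\<close> to \<open>v\<close> with at most \<open>d\<close> edges has second vertex \<open>z\<close> and last but one vertex \<open>y\<close>.
  Only the facts about such a path that the colouring needs are recorded.
\<close>
definition path_ends :: "('a \<times> 'a) set \<Rightarrow> nat \<Rightarrow> 'a \<Rightarrow> 'a \<Rightarrow> 'a \<Rightarrow> 'a \<Rightarrow> bool" where
  "path_ends E d u v z y \<longleftrightarrow> (u, z) \<in> E \<and> (y, v) \<in> E \<and>
     (\<exists>n<d. (z, v) \<in> Restr E (- {u}) ^^ n) \<and> (\<exists>n<d. (u, y) \<in> Restr E (- {v}) ^^ n) \<and>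
     (z = v \<and> y = u \<or> (\<exists>n. n + 1 < d \<and> (z, y) \<in> E ^^ n))"

lemma relpow_mono_set:
  fixes R S :: "('a \<times> 'a) set"
  shows "(a, b) \<in> R ^^ n \<Longrightarrow> R \<subseteq> S \<Longrightarrow> (a, b) \<in> S ^^ n"
proof (induction n arbitrary: b)
  case (Suc n)
  then obtain c where "(a, c) \<in> R ^^ n" "(c, b) \<in> R" by auto
  with Suc.IH Suc.prems(2) have "(a, c) \<in> S ^^ n" "(c, b) \<in> S" by blast+
  then show ?case by auto
qed simp

lemma sym_Restr_rtrancl:
  assumes "sym E" "(a, b) \<in> (Restr E S)\<^sup>*"
  shows "(b, a) \<in> (Restr E S)\<^sup>*"
proof -
  have "sym (Restr E S)" using assms(1) by (auto simp: sym_def)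
  then show ?thesis using assms(2) by (meson sym_rtrancl symD)
qed

text \<open>\<open>acyclic\<close> is how being a tree enters: neighbours of v that are joined off v
  coincide. \<open>generic\<close> is what the choice of offsets will supply. Together they force a
  single edge at \<open>x j\<close> once it has both incoming and outgoing pairs; the colour records
  on which side that edge lies, or which kind of pair is missing.\<close>

lemma tree_served_pairs_4_colourable:
  fixes E :: "(nat \<times> nat) set" and r x :: "nat \<Rightarrow> nat"
  assumes sym: "sym E"
    and irrefl: "\<And>a. (a, a) \<notin> E"
    and bound: "\<And>a b. (a, b) \<in> E \<Longrightarrow> b \<le> a + m"
    and acyclic: "\<And>v y z. (v, y) \<in> E \<Longrightarrow> (v, z) \<in> E \<Longrightarrow> (y, z) \<in> (Restr E (- {v}))\<^sup>* \<Longrightarrow> y = z"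
    and x: "\<And>i. x i = i * m + r i"
    and r_less: "\<And>i. i < N \<Longrightarrow> r i < m"
    and generic: "\<And>i j l z y z' y'. i < j \<Longrightarrow> j < l \<Longrightarrow> l < N \<Longrightarrow>
      path_ends E (j - i + 1) (x i) (x j) z y \<Longrightarrow>
      path_ends E (l - j + 1) (x j) (x l) z' y' \<Longrightarrow> (x i, x l) \<in> (Restr E (- {x j}))\<^sup>*"
  obtains c :: "nat \<Rightarrow> nat" where "\<And>i. c i < 4"
    "\<And>i j z y. i < j \<Longrightarrow> j < N \<Longrightarrow> path_ends E (j - i + 1) (x i) (x j) z y \<Longrightarrow> c i \<noteq> c j"
proof -
  define srv where "srv i j z y \<longleftrightarrow> i < j \<and> j < N \<and> path_ends E (j - i + 1) (x i) (x j) z y"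
    for i j z y
  define inn where "inn j \<longleftrightarrow> (\<exists>i z y. srv i j z y)" for j
  define out where "out j \<longleftrightarrow> (\<exists>l z y. srv j l z y)" for j
  define right where "right j \<longleftrightarrow> (\<exists>i z y. srv i j z y \<and> x j < y)" for j
  define c :: "nat \<Rightarrow> nat" where
    "c j = (if \<not> inn j then 0 else if \<not> out j then 1 else if right j then 2 else 3)" for j
  \<comment> \<open>Off \<open>x j\<close>, the vertex y is joined to \<open>x i\<close>,
    \<open>x i\<close> to \<open>x l\<close> by \<open>generic\<close>, and \<open>x l\<close> to
    z'. So y and z' are neighbours of \<open>x j\<close> in one component of the rest.\<close>
  have same: "y = z'" if "srv i j z y" "srv j l z' y'" for i j l z y z' y'
  proof (rule acyclic)
    have *: "path_ends E (j - i + 1) (x i) (x j) z y" "path_ends E (l - j + 1) (x j) (x l) z' y'"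
      "i < j" "j < l" "l < N"
      using that by (auto simp: srv_def)
    show "(x j, y) \<in> E" "(x j, z') \<in> E"
      using * sym by (auto simp: path_ends_def dest: symD)
    have "(x i, y) \<in> (Restr E (- {x j}))\<^sup>*" "(z', x l) \<in> (Restr E (- {x j}))\<^sup>*"
      using * by (auto simp: path_ends_def dest: relpow_imp_rtrancl)
    with generic[OF *(3,4,5,1,2)] sym_Restr_rtrancl[OF sym]
    show "(y, z') \<in> (Restr E (- {x j}))\<^sup>*" by (meson rtrancl_trans)
  qed
  have upper: "w \<le> v + m * n" if "(v, w) \<in> E ^^ n'" "n' \<le> n" for v w n n'
  proof -
    have "w \<le> v + m * n'" using relpow_le_add_mult[OF that(1) bound] .
    also have "\<dots> \<le> v + m * n" using that(2) by simp
    finally show ?thesis .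
  qed
  have x_mono: "x i < x j" if "i < j" "i < N" for i j
  proof -
    have "(i + 1) * m \<le> j * m" using that by (intro mult_le_mono1) simp
    then show ?thesis using r_less[OF that(2)] by (simp add: x)
  qed
  \<comment> \<open>Without its two end edges a path with at most \<open>j - i + 1\<close> edges has
    at most \<open>j - i - 1\<close>; this saves a full m. A one-edge path has no such middle and is
    excluded.\<close>
  have middle: "y + m \<le> z + m * (j - i)" if s: "srv i j z y" "\<not> (z = x j \<and> y = x i)" for i j z y
  proof -
    obtain n where n: "n + 1 < j - i + 1" "(z, y) \<in> E ^^ n"
      using s unfolding srv_def path_ends_def by blast
    then have "y \<le> z + m * (j - i - 1)" by (intro upper) auto
    moreover have "m * (j - i) = m * (j - i - 1) + m" using n(1) by (cases "j - i") auto
    ultimately show ?thesis by linarith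
  qed
  have diff: "m * (j - i) + i * m = j * m" if "i < j" for i j
    using that by (metis add.commute add_mult_distrib le_add_diff_inverse less_imp_le mult.commute)
  \<comment> \<open>The path coming into \<open>x i\<close> gives \<open>z < (i + 1) * m\<close>,
    hence \<open>y < j * m\<close> by \<open>middle\<close>; but
    \<open>y > x j \<ge> j * m\<close>.\<close>
  have right_indep: False if s: "srv i j z y" and ri: "right i" and rj: "right j" and oj: "out j" for i j z y
  proof -
    obtain h z1 y1 where h: "srv h i z1 y1" "x i < y1" using ri by (auto simp: right_def)
    have z: "y1 = z" using same[OF h(1) s] .
    obtain h' z2 y2 where h': "srv h' j z2 y2" "x j < y2" using rj by (auto simp: right_def)
    obtain l z3 y3 where l: "srv j l z3 y3" using oj by (auto simp: out_def)
    have y: "y = y2" using same[OF s l] same[OF h'(1) l] by simp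
    have hi: "h < i" "i < j" "h < N" "i < N" using h s by (auto simp: srv_def)
    obtain n where "n < i - h + 1" "(x h, y1) \<in> E ^^ n"
      using h(1) by (auto simp: srv_def path_ends_def intro: relpow_mono_set)
    then have "z \<le> x h + m * (i - h)" unfolding z[symmetric] by (intro upper) auto
    moreover have "y + m \<le> z + m * (j - i)"
      using middle[OF s] h'(2) y x_mono[of i j] hi by fastforce
    moreover have "j * m < y" using h'(2) y by (simp add: x)
    ultimately show False
      using diff[OF hi(1)] diff[OF hi(2)] r_less[OF hi(3)] by (simp add: x)
  qed
  \<comment> \<open>Here \<open>z < x i < (i + 1) * m\<close> gives \<open>y < j * m\<close> by
    \<open>middle\<close>, while from y the vertex \<open>x l \<ge> l * m\<close> is reached in at
    most \<open>l - j\<close> edges, so \<open>y \<ge> j * m\<close>.\<close>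
  have left_indep: False
    if s: "srv i j z y" and ii: "inn i" and ri: "\<not> right i" and rj: "\<not> right j" and oj: "out j"
    for i j z y
  proof -
    obtain h z1 y1 where h: "srv h i z1 y1" using ii by (auto simp: inn_def)
    have z: "y1 = z" using same[OF h s] .
    have "z \<noteq> x i" using s irrefl by (auto simp: srv_def path_ends_def)
    then have zi: "z < x i" using ri h z by (force simp: right_def)
    obtain l z3 y3 where l: "srv j l z3 y3" using oj by (auto simp: out_def)
    have y: "y = z3" using same[OF s l] .
    have ij: "i < j" "j < l" "i < N" using s l by (auto simp: srv_def)
    obtain n where "n < l - j + 1" "(z3, x l) \<in> E ^^ n"
      using l by (auto simp: srv_def path_ends_def intro: relpow_mono_set)
    then have "x l \<le> z3 + m * (l - j)" by (intro upper) auto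
    moreover have "y + m \<le> z + m * (j - i)"
      using middle[OF s] zi x_mono[of i j] ij by fastforce
    ultimately show False
      using zi diff[OF ij(1)] diff[OF ij(2)] r_less[OF ij(3)] y by (simp add: x)
  qed
  show thesis
  proof (rule that)
    show "c i < 4" for i by (simp add: c_def)
    fix i j z y assume "i < j" "j < N" "path_ends E (j - i + 1) (x i) (x j) z y"
    then have s: "srv i j z y" by (simp add: srv_def)
    \<comment> \<open>These rule out a common colour 0 or 1. A common colour 2 or 3 brings
      \<open>inn i\<close> and \<open>out j\<close>, as the two independence facts require.\<close>
    then have "inn j" "out i" by (auto simp: inn_def out_def)
    then show "c i \<noteq> c j"
      using right_indep[OF s] left_indep[OF s] by (auto simp: c_def)
  qed
qed

text \<open>The union bound for a uniformly random \<open>f\<close>, in counting form.\<close>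
lemma exists_function_avoiding:
  fixes B :: "'c \<Rightarrow> ('i \<Rightarrow> nat) \<Rightarrow> nat set"
  assumes "finite I" "finite C"
    and j: "\<And>c. c \<in> C \<Longrightarrow> j c \<in> I"
    and indep: "\<And>c f v. c \<in> C \<Longrightarrow> B c (f(j c := v)) = B c f"
    and fin: "\<And>c f. c \<in> C \<Longrightarrow> finite (B c f)"
    and card: "\<And>c f. c \<in> C \<Longrightarrow> card (B c f) \<le> s"
    and less: "card C * s < M"
  shows "\<exists>f \<in> I \<rightarrow> {..<M}. \<forall>c\<in>C. f (j c) \<notin> B c f"
proof (rule ccontr)
  assume contra: "\<not> ?thesis"
  \<comment> \<open>Functions violating c are grouped by their values off \<open>j c\<close>. By
    \<open>indep\<close> the forbidden set at \<open>j c\<close> depends on those values alone, so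
    each group has at most s members.\<close>
  define bad where "bad c = (\<Union>g \<in> PiE (I - {j c}) (\<lambda>_. {..<M}). (\<lambda>v. g(j c := v)) ` B c g)" for c
  have fin_bad: "finite (bad c)" if "c \<in> C" for c
    using that assms(1) fin by (auto simp: bad_def intro!: finite_PiE)
  have card_bad: "card (bad c) \<le> M ^ (card I - 1) * s" if "c \<in> C" for c
  proof -
    have "card (bad c) \<le> (\<Sum>g \<in> PiE (I - {j c}) (\<lambda>_. {..<M}). card ((\<lambda>v. g(j c := v)) ` B c g))"
      unfolding bad_def using assms(1) by (intro card_UN_le finite_PiE) auto
    also have "\<dots> \<le> (\<Sum>g \<in> PiE (I - {j c}) (\<lambda>_. {..<M}). s)"
      using that fin card by (intro sum_mono) (meson card_image_le order_trans)
    also have "\<dots> = M ^ (card I - 1) * s"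
      using assms(1) j[OF that] by (simp add: card_PiE)
    finally show ?thesis .
  qed
  have "PiE I (\<lambda>_. {..<M}) \<subseteq> (\<Union>c\<in>C. bad c)"
  proof
    fix f assume f: "f \<in> PiE I (\<lambda>_. {..<M})"
    then have "f \<in> I \<rightarrow> {..<M}" by auto
    with contra obtain c where c: "c \<in> C" "f (j c) \<in> B c f" by blast
    define g where "g = f(j c := undefined)"
    have "g \<in> PiE (I - {j c}) (\<lambda>_. {..<M})" using f by (auto simp: g_def PiE_iff extensional_def)
    moreover have "f = g(j c := f (j c))" by (simp add: g_def)
    moreover have "f (j c) \<in> B c g" using c indep by (simp add: g_def)
    ultimately have "f \<in> bad c" unfolding bad_def by blast
    then show "f \<in> (\<Union>c\<in>C. bad c)" using c by blast
  qed
  then have "card (PiE I (\<lambda>_. {..<M})) \<le> card (\<Union>c\<in>C. bad c)"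
    using assms(2) fin_bad by (intro card_mono) auto
  also have "\<dots> \<le> (\<Sum>c\<in>C. card (bad c))" using assms(2) by (rule card_UN_le)
  also have "\<dots> \<le> card C * (M ^ (card I - 1) * s)"
    using card_bad sum_bounded_above[of C "\<lambda>c. card (bad c)"] by auto
  finally have le: "M ^ card I \<le> (card C * s) * M ^ (card I - 1)"
    using assms(1) by (simp add: card_PiE mult.assoc mult.commute mult.left_commute)
  have "C \<noteq> {}"
  proof
    assume "C = {}"
    then show False using contra less by auto
  qed
  then have "I \<noteq> {}" using j by auto
  then have "M ^ card I = M * M ^ (card I - 1)"
    using assms(1) by (metis card_gt_0_iff power_eq_if not_gr_zero)
  with le have "M * M ^ (card I - 1) \<le> (card C * s) * M ^ (card I - 1)" by simp
  moreover have "0 < M ^ (card I - 1)" using less by simp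
  ultimately show False using less by simp
qed

section \<open>Trees and shortest paths\<close>

context pair_wf_digraph begin

lemma awalk_imp_relpow:
  assumes "awalk u p v" "set (awalk_verts u p) \<subseteq> S"
  shows "(u, v) \<in> Restr (parcs G) S ^^ length p"
  using assms
proof (induction p arbitrary: u)
  case (Cons e es)
  then have "snd e \<in> S" using hd_in_awalk_verts(1)[of "snd e" es v] by (auto simp: awalk_Cons_iff)
  with Cons have "(u, snd e) \<in> Restr (parcs G) S" "(snd e, v) \<in> Restr (parcs G) S ^^ length es"
    by (auto simp: awalk_Cons_iff mem_Times_iff)
  then show ?case unfolding length_Cons by (rule relpow_Suc_I2)
qed (auto simp: awalk_Nil_iff)

lemma relpow_imp_awalk:
  assumes "(u, v) \<in> Restr (parcs G) S ^^ n" "u \<in> pverts G"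
  shows "\<exists>p. awalk u p v \<and> length p = n \<and> set p \<subseteq> S \<times> S"
  using assms
proof (induction n arbitrary: u)
  case 0
  then show ?case by (auto simp: awalk_Nil_iff)
next
  case (Suc n)
  then obtain w where w: "(u, w) \<in> Restr (parcs G) S" "(w, v) \<in> Restr (parcs G) S ^^ n"
    by (meson relpow_Suc_D2)
  moreover have "w \<in> pverts G" using w by (auto dest: in_arcsD2)
  ultimately obtain p where "awalk w p v" "length p = n" "set p \<subseteq> S \<times> S" using Suc.IH by blast
  with w show ?case by (intro exI[of _ "(u, w) # p"]) (auto simp: awalk_Cons_iff)
qed

lemma apath_imp_path_ends:
  assumes p: "apath u p v" "length p \<le> d" "u \<noteq> v"
  shows "\<exists>z y. path_ends (parcs G) d u v z y"
proof -
  have "p \<noteq> []" using p by (auto simp: apath_Nil_iff)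
  then obtain e q where eq: "p = e # q" by (cases p) auto
  define z where "z = snd e"
  have first: "(u, z) \<in> parcs G" "apath z q v" "u \<notin> set (awalk_verts z q)"
    using p eq by (auto simp: apath_Cons_iff z_def)
  have q: "(z, v) \<in> Restr (parcs G) (- {u}) ^^ length q"
    using first by (intro awalk_imp_relpow) (auto simp: apath_def)
  obtain q' e' where eq': "p = q' @ [e']" using \<open>p \<noteq> []\<close> by (metis append_butlast_last_id)
  define y where "y = fst e'"
  have last: "(y, v) \<in> parcs G" "apath u q' y" "v \<notin> set (awalk_verts u q')"
    using p eq' by (auto simp: apath_append_iff apath_simps y_def) (metis prod.collapse)
  have q': "(u, y) \<in> Restr (parcs G) (- {v}) ^^ length q'"
    using last by (intro awalk_imp_relpow) (auto simp: apath_def)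
  \<comment> \<open>An empty \<open>q'\<close> means that the path is a single edge. Otherwise p is
    \<open>e\<close>, then \<open>r\<close>, then \<open>e'\<close>, and \<open>r\<close> leads from
    z to y.\<close>
  have "z = v \<and> y = u \<or> (\<exists>n. n + 1 < d \<and> (z, y) \<in> parcs G ^^ n)"
  proof (cases q')
    case Nil
    then show ?thesis using eq eq' first last by (auto simp: apath_Nil_iff)
  next
    case (Cons e2 r)
    then have [simp]: "e2 = e" using eq eq' by simp
    have "awalk z r y" using last(2) Cons by (auto simp: apath_def awalk_Cons_iff z_def)
    then have "(z, y) \<in> Restr (parcs G) UNIV ^^ length r" by (rule awalk_imp_relpow) simp
    then show ?thesis using Cons eq' p(2) by auto
  qed
  moreover have "length q < d" "length q' < d" using p(2) arg_cong[OF eq, of length] arg_cong[OF eq', of length] by auto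
  ultimately have "path_ends (parcs G) d u v z y"
    unfolding path_ends_def using first(1) last(1) q q' by blast
  then show ?thesis by blast
qed

lemma graph_dist_le:
  assumes "(u, v) \<in> parcs G ^^ n" "u \<in> pverts G"
  shows "graph_dist G u v \<le> ereal (real n)"
proof -
  have len: "awalk_cost (\<lambda>_. 1) q = real (length q)" for q
    by (induct q) auto
  obtain p where "awalk u p v" "length p = n"
    using relpow_imp_awalk[of u v n UNIV] assms by auto
  then show ?thesis
    using min_cost_le_walk_cost[of u p v "\<lambda>_. 1"] by (simp add: graph_dist_def len)
qed

end

lemma simple_connected_graphI:
  assumes "pair_graph G" "u \<in> pverts G"
    and reach: "\<And>v. v \<in> pverts G \<Longrightarrow> (u, v) \<in> (parcs G)\<^sup>*"
  shows "simple_connected_graph G"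
proof -
  interpret pair_graph G by fact
  have "v \<rightarrow>\<^sup>*\<^bsub>with_proj G\<^esub> w" if "v \<in> pverts G" "w \<in> pverts G" for v w
  proof -
    have "sym (parcs G)" by (auto simp: sym_def intro: arcs_symmetric)
    then have "(v, w) \<in> (parcs G)\<^sup>*"
      using reach[OF that(1)] reach[OF that(2)] by (meson rtrancl_trans sym_rtrancl symD)
    then obtain n where "(v, w) \<in> Restr (parcs G) UNIV ^^ n"
      by (auto dest: rtrancl_imp_relpow)
    then show ?thesis using relpow_imp_awalk that(1) by (blast intro: reachable_awalkI)
  qed
  then have "Digraph_Component.connected G"
    using assms(2) reachable_mk_symmetric_eq[OF sym_arcs]
    by (auto simp: Digraph_Component.connected_def strongly_connected_def mk_symmetric_def)
  then show ?thesis using assms(1) by (simp add: simple_connected_graph_def)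
qed

lemma graph_dist_apath:
  assumes "simple_connected_graph G" "u \<in> pverts G" "v \<in> pverts G"
  obtains p where "pre_digraph.apath G u p v" "graph_dist G u v = ereal (real (length p))"
  using graph_dist_shortest_path[OF assms] by blast

text \<open>A simple path from y to z off v closes up through v to a cycle. Distinctness of y and z
  makes the path nonempty, so the cycle has at least three arcs and is not a back-and-forth
  walk.\<close>

lemma undirected_treeD:
  assumes T: "undirected_tree T"
    and arcs: "(v, y) \<in> parcs T" "(v, z) \<in> parcs T"
    and yz: "(y, z) \<in> (Restr (parcs T) (- {v}))\<^sup>*"
  shows "y = z"
proof (rule ccontr)
  assume "y \<noteq> z"
  interpret pair_graph T
    using T by (simp add: undirected_tree_def simple_connected_graph_def)
  have verts: "y \<in> pverts T" "v \<in> pverts T" using arcs by (auto dest: wellformed')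
  obtain n where "(y, z) \<in> Restr (parcs T) (- {v}) ^^ n" using yz by (meson rtrancl_imp_relpow)
  then obtain q where q: "awalk y q z" "set q \<subseteq> (- {v}) \<times> (- {v})"
    using relpow_imp_awalk verts by blast
  define p where "p = awalk_to_apath q"
  have p: "apath y p z" "set p \<subseteq> (- {v}) \<times> (- {v})"
    using q awalk_to_apath_subset[OF q(1)] apath_awalk_to_apath[OF q(1)] by (auto simp: p_def)
  have "p \<noteq> []" using p \<open>y \<noteq> z\<close> by (auto simp: apath_Nil_iff)
  have "y \<noteq> v" using arcs no_loops by fastforce
  then have "v \<notin> set (awalk_verts y p)"
    using p set_awalk_verts[of y p z] by (auto simp: apath_def)
  then have "awalk z ((z, v) # (v, y) # p) z" "distinct (tl (awalk_verts z ((z, v) # (v, y) # p)))"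
    using p arcs verts arcs_symmetric by (auto simp: awalk_Cons_iff apath_def)
  then have "cycle ((z, v) # (v, y) # p)" by (auto simp: cycle_def)
  moreover have "3 \<le> length ((z, v) # (v, y) # p)" using \<open>p \<noteq> []\<close> by (cases p) auto
  ultimately show False using T by (auto simp: undirected_tree_def)
qed

lemma (in pair_wf_digraph) cas_nth:
  assumes "pcas u p v" "Suc i < length p"
  shows "fst (p ! Suc i) = snd (p ! i)"
  using assms
proof (induction p arbitrary: u i)
  case (Cons e es)
  then show ?case by (cases i; cases es) auto
qed simp

text \<open>A highest vertex of a cycle would need two different parents.\<close>
lemma (in pair_wf_digraph) no_cycle_if_parent:
  fixes d :: "'a \<Rightarrow> nat"
  assumes parent: "\<And>a b. (a, b) \<in> parcs G \<Longrightarrow> d b < d a \<and> b = par a \<or> d a < d b \<and> a = par b"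
    and cyc: "cycle p" "3 \<le> length p"
  shows False
proof -
  obtain u where u: "awalk u p u" "distinct (tl (awalk_verts u p))" using cyc by (auto simp: cycle_def)
  have "p \<noteq> []" using cyc by auto
  then have dist: "distinct (map snd p)"
    using u awalk_verts_conv'[of u p u] by (auto simp: awalk_def)
  define L where "L = length p"
  define s where "s i = Suc i mod L" for i
  have s_less: "s i < L" for i using \<open>p \<noteq> []\<close> by (simp add: s_def L_def)
  have step: "fst (p ! s i) = snd (p ! i)" if "i < L" for i
  proof (cases "Suc i < L")
    case True
    then show ?thesis using cas_nth[of u p u i] u by (auto simp: awalk_def s_def L_def)
  next
    case False
    then have i: "Suc i = L" using that by simp
    then have "s i = 0" by (simp add: s_def)
    moreover have "fst (p ! 0) = u" using u \<open>p \<noteq> []\<close> by (cases p) (auto simp: awalk_def)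
    moreover have "snd (last p) = u"
      using u \<open>p \<noteq> []\<close> awlast_of_awalk[OF u(1)] awalk_verts_conv[of u p]
      by (metis awalkE' last_snoc with_proj_simps(5))
    moreover have "last p = p ! i"
      using i \<open>p \<noteq> []\<close> by (metis L_def diff_Suc_1 last_conv_nth)
    ultimately show ?thesis by simp
  qed
  \<comment> \<open>Take the arc i with the highest head. The heads of the cyclically preceding arc
    h and of the following arc \<open>s i\<close> are adjacent to it, so both equal its parent,
    against distinctness of the heads.\<close>
  have "\<exists>i\<in>{..<L}. \<forall>j\<in>{..<L}. d (snd (p ! j)) \<le> d (snd (p ! i))"
  proof -
    have "finite {..<L}" "{..<L} \<noteq> {}" using \<open>p \<noteq> []\<close> by (auto simp: L_def)
    then show ?thesis
      using Max_in[of "(\<lambda>j. d (snd (p ! j))) ` {..<L}"] Max_ge[of "(\<lambda>j. d (snd (p ! j))) ` {..<L}"]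
      by fastforce
  qed
  then obtain i where i: "i < L" "\<And>j. j < L \<Longrightarrow> d (snd (p ! j)) \<le> d (snd (p ! i))" by auto
  define h where "h = (i + L - 1) mod L"
  have h: "h < L" "s h = i"
    using i by (auto simp: h_def s_def mod_Suc_eq)
  have arc: "p ! j \<in> parcs G" if "j < L" for j
    using u that by (auto simp: awalk_def L_def)
  have "(snd (p ! h), snd (p ! i)) \<in> parcs G"
    using arc[OF i(1)] step[OF h(1)] h(2) by (metis prod.collapse)
  then have "snd (p ! h) = par (snd (p ! i))" using parent i(2)[OF h(1)] by fastforce
  moreover have "(snd (p ! i), snd (p ! s i)) \<in> parcs G"
    using arc[OF s_less[of i]] step[OF i(1)] by (metis prod.collapse)
  then have "snd (p ! s i) = par (snd (p ! i))" using parent i(2)[OF s_less[of i]] by fastforce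
  ultimately have "map snd p ! h = map snd p ! s i" using h s_less by (auto simp: L_def)
  then have "h = s i"
    using dist h s_less by (metis L_def length_map nth_eq_iff_index_eq)
  \<comment> \<open>Cyclic predecessor and successor differ because L is at least 3.\<close>
  moreover have "h \<noteq> s i"
    using i(1) cyc(2) by (cases i; cases "Suc i = L") (auto simp: h_def s_def L_def)
  ultimately show False by simp
qed

section \<open>Shortest path trees and attainment of the tree number\<close>

text \<open>Breadth-first search: every vertex other than the root is attached to a neighbour one
  step closer to the root. The level \<open>d\<close> then serves as height in
  \<open>no_cycle_if_parent\<close>.\<close>

lemma exists_shortest_path_tree:
  assumes G: "simple_connected_graph G" and u: "u \<in> pverts G"
  shows "\<exists>T. undirected_spanning_tree T G \<and> (\<forall>v\<in>pverts G. graph_dist T u v \<le> graph_dist G u v)"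
proof -
  interpret pair_graph G using G by (simp add: simple_connected_graph_def)
  define d where "d v = (LEAST n. (u, v) \<in> parcs G ^^ n)" for v
  have walk: "(u, v) \<in> parcs G ^^ length p" if "apath u p v" for p v
    using awalk_imp_relpow[of u p v UNIV] that by (auto simp: apath_def)
  have d: "(u, v) \<in> parcs G ^^ d v" if "v \<in> pverts G" for v
    unfolding d_def using graph_dist_apath[OF G u that] walk by (metis LeastI)
  have d_le: "d v \<le> n" if "(u, v) \<in> parcs G ^^ n" for v n
    unfolding d_def using that by (rule Least_le)
  have "\<exists>w. (w, v) \<in> parcs G \<and> d v = Suc (d w)" if v: "v \<in> pverts G" "v \<noteq> u" for v
  proof (cases "d v")
    case 0
    then show ?thesis using d[OF v(1)] v(2) by simp
  next
    case (Suc n)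
    then obtain w where w: "(u, w) \<in> parcs G ^^ n" "(w, v) \<in> parcs G"
      using d[OF v(1)] by auto
    have "d v \<le> Suc (d w)"
      using d[of w] w(2) by (intro d_le) (auto dest: in_arcsD1)
    with d_le[OF w(1)] Suc w(2) show ?thesis by (intro exI[of _ w]) simp
  qed
  then obtain par where par: "\<And>v. v \<in> pverts G \<Longrightarrow> v \<noteq> u \<Longrightarrow> (par v, v) \<in> parcs G \<and> d v = Suc (d (par v))"
    by metis
  define A where "A = (\<lambda>v. (par v, v)) ` (pverts G - {u})"
  define T where "T = \<lparr> pverts = pverts G, parcs = A \<union> A\<inverse> \<rparr>"
  have sub: "parcs T \<subseteq> parcs G"
    using par by (auto simp: T_def A_def intro: arcs_symmetric)
  have T: "pair_graph T"
  proof
    show "symmetric T" by (auto simp: symmetric_def sym_def T_def)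
    show "finite (parcs T)" using sub pair_finite_arcs by (rule finite_subset)
    show "finite (pverts T)" by (simp add: T_def pair_finite_verts)
    fix e assume "e \<in> parcs T"
    then have "e \<in> parcs G" using sub by blast
    then show "fst e \<in> pverts T" "snd e \<in> pverts T" "fst e \<noteq> snd e"
      using arc_fst_in_verts arc_snd_in_verts pair_no_loops by (auto simp: T_def)
  qed
  interpret T: pair_graph T by fact
  have T_walk: "(u, v) \<in> parcs T ^^ d v" if "v \<in> pverts G" for v
    using that
  proof (induction "d v" arbitrary: v)
    case 0
    then show ?case using d[OF 0(2)] by simp
  next
    case (Suc n)
    have "v \<noteq> u" using Suc.hyps(2) d_le[of u 0] by auto
    note p = par[OF Suc.prems this]
    have "(par v, v) \<in> parcs T" using Suc.prems \<open>v \<noteq> u\<close> by (auto simp: T_def A_def)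
    moreover have "(u, par v) \<in> parcs T ^^ d (par v)"
      using Suc.hyps p by (auto dest: in_arcsD1)
    ultimately show ?case using p by auto
  qed
  have conn: "simple_connected_graph T"
    using T u T_walk by (intro simple_connected_graphI[of T u]) (auto simp: T_def dest: relpow_imp_rtrancl)
  have "\<not> (T.cycle p \<and> 3 \<le> length p)" for p
    using T.no_cycle_if_parent[of d par p] par by (force simp: T_def A_def)
  with conn have tree: "undirected_tree T" by (auto simp: undirected_tree_def)
  have "wf_digraph (with_proj T)" "wf_digraph (with_proj G)" by unfold_locales
  then have "spanning T G"
    using sub by (simp add: spanning_def subgraph_def compatible_def) (simp add: T_def)
  moreover have "graph_dist T u v \<le> graph_dist G u v" if v: "v \<in> pverts G" for v
  proof -
    obtain p where p: "apath u p v" "graph_dist G u v = ereal (real (length p))"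
      using graph_dist_apath[OF G u v] by blast
    have "graph_dist T u v \<le> ereal (real (d v))"
      using T_walk[OF v] u by (intro T.graph_dist_le) (auto simp: T_def)
    also have "\<dots> \<le> graph_dist G u v" using d_le[OF walk[OF p(1)]] p(2) by simp
    finally show ?thesis .
  qed
  ultimately show ?thesis using tree by (auto simp: undirected_spanning_tree_def)
qed

text \<open>One shortest path tree rooted at each vertex. This makes the \<open>LEAST\<close> in
  \<open>plus_one_tree_number\<close> attained, and the bound by the number of vertices makes the
  set under \<open>Max\<close> finite.\<close>

lemma exists_collectively_spanning:
  assumes G: "simple_connected_graph G"
  shows "\<exists>\<T>. finite \<T> \<and> card \<T> \<le> card (pverts G) \<and> collectively_plus_one_spans \<T> G"
proof -
  interpret pair_graph G using G by (simp add: simple_connected_graph_def)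
  obtain T where T: "\<And>u. u \<in> pverts G \<Longrightarrow> undirected_spanning_tree (T u) G \<and>
      (\<forall>v\<in>pverts G. graph_dist (T u) u v \<le> graph_dist G u v)"
    using exists_shortest_path_tree[OF G] by metis
  have "collectively_plus_one_spans (T ` pverts G) G"
    unfolding collectively_plus_one_spans_def
  proof (intro conjI ballI)
    fix u v assume uv: "u \<in> pverts G" "v \<in> pverts G"
    have "graph_dist (T u) u v \<le> graph_dist G u v" using T uv by blast
    also have "\<dots> \<le> graph_dist G u v + 1" by (cases "graph_dist G u v") auto
    finally show "\<exists>S\<in>T ` pverts G. graph_dist S u v \<le> graph_dist G u v + 1" using uv by blast
  qed (use T in auto)
  then show ?thesis using pair_finite_verts by (metis card_image_le finite_imageI)
qed

lemma plus_one_tree_number_le: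
  assumes "simple_connected_graph G"
  shows "plus_one_tree_number G \<le> card (pverts G)"
proof -
  obtain \<T> where *: "finite \<T>" "card \<T> \<le> card (pverts G)" "collectively_plus_one_spans \<T> G"
    using exists_collectively_spanning[OF assms] by blast
  have "plus_one_tree_number G \<le> card \<T>"
    unfolding plus_one_tree_number_def using * by (intro Least_le) blast
  with *(2) show ?thesis by simp
qed

lemma plus_one_tree_number_witness:
  assumes "simple_connected_graph G"
  obtains \<T> where "finite \<T>" "card \<T> = plus_one_tree_number G" "collectively_plus_one_spans \<T> G"
proof -
  have "\<exists>k \<T>. finite \<T> \<and> card \<T> = k \<and> collectively_plus_one_spans \<T> G"
    using exists_collectively_spanning[OF assms] by blast
  from LeastI_ex[OF this] show thesis using that unfolding plus_one_tree_number_def by blast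
qed

lemma plus_one_tree_number_le_max:
  fixes G :: "nat pair_pre_digraph"
  assumes "unit_interval_graph G"
  shows "plus_one_tree_number G \<le> max_plus_one_tree_number (card (pverts G))"
  unfolding max_plus_one_tree_number_def
proof (rule Max_ge)
  show "finite {plus_one_tree_number H | H :: nat pair_pre_digraph.
      unit_interval_graph H \<and> card (pverts H) = card (pverts G)}"
    by (rule finite_subset[of _ "{..card (pverts G)}"])
      (auto simp: unit_interval_graph_def dest!: plus_one_tree_number_le)
qed (use assms in auto)

section \<open>Powers of paths\<close>

definition power_path :: "nat \<Rightarrow> nat \<Rightarrow> nat pair_pre_digraph" where
  "power_path n m = \<lparr> pverts = {..<n},
     parcs = {(u, v). u < n \<and> v < n \<and> u \<noteq> v \<and> u \<le> v + m \<and> v \<le> u + m} \<rparr>"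

lemma pair_graph_power_path: "pair_graph (power_path n m)"
proof
  show "finite (parcs (power_path n m))"
    by (rule finite_subset[of _ "{..<n} \<times> {..<n}"]) (auto simp: power_path_def)
qed (auto simp: power_path_def symmetric_def sym_def)

lemma power_path_relpow:
  assumes "u \<le> v" "v \<le> u + m * k" "v < n"
  shows "\<exists>k'\<le>k. (u, v) \<in> parcs (power_path n m) ^^ k'"
  using assms
proof (induction k arbitrary: v)
  case 0
  then show ?case by auto
next
  case (Suc k)
  show ?case
  proof (cases "v \<le> u + m * k")
    case True
    with Suc show ?thesis by (meson le_SucI)
  next
    case False
    \<comment> \<open>The last step has length m, cut off at u so that the induction hypothesis
      still applies to w.\<close>
    define w where "w = max u (v - m)"
    have "0 < m" "u < v" using False Suc.prems by (auto intro: gr0I)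
    then have w: "u \<le> w" "w \<le> u + m * k" "w < n" "(w, v) \<in> parcs (power_path n m)"
      using Suc.prems by (auto simp: w_def power_path_def)
    then obtain k' where "k' \<le> k" "(u, w) \<in> parcs (power_path n m) ^^ k'"
      using Suc.IH by blast
    with w(4) show ?thesis by (intro exI[of _ "Suc k'"]) auto
  qed
qed

lemma simple_connected_power_path:
  assumes "0 < n" "0 < m"
  shows "simple_connected_graph (power_path n m)"
proof (rule simple_connected_graphI[OF pair_graph_power_path])
  show "0 \<in> pverts (power_path n m)" using assms by (simp add: power_path_def)
  fix v assume "v \<in> pverts (power_path n m)"
  then have "v < n" "v \<le> 0 + m * v" using assms by (auto simp: power_path_def)
  then obtain k where "(0, v) \<in> parcs (power_path n m) ^^ k"
    using power_path_relpow[of 0 v m v n] by auto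
  then show "(0, v) \<in> (parcs (power_path n m))\<^sup>*" by (rule relpow_imp_rtrancl)
qed

lemma unit_interval_power_path:
  assumes "0 < n" "0 < m"
  shows "unit_interval_graph (power_path n m)"
  unfolding unit_interval_graph_def
proof (intro conjI exI ballI impI)
  show "simple_connected_graph (power_path n m)" using assms by (rule simple_connected_power_path)
  \<comment> \<open>The interval of u is [u, u + m]; this goal and the last one fix the witnesses by
    unification.\<close>
  show "0 < real m" using assms by simp
  fix u v assume *: "u \<in> pverts (power_path n m)" "v \<in> pverts (power_path n m)" "u \<noteq> v"
  have "{real u..real u + real m} \<inter> {real v..real v + real m} \<noteq> {} \<longleftrightarrow>
      real u \<le> real (v + m) \<and> real v \<le> real (u + m)"
    by (simp add: Int_atLeastAtMost) (auto simp: max_def min_def)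
  then show "(u, v) \<in> parcs (power_path n m) \<longleftrightarrow>
      {real u..real u + real m} \<inter> {real v..real v + real m} \<noteq> {}"
    using * unfolding of_nat_le_iff by (auto simp: power_path_def)
qed

section \<open>Generic offsets and the lower bound on the number of trees\<close>

text \<open>S is the vertex set of a walk. Its size will bound the number of offsets that place some
  \<open>x j\<close> on a route.\<close>

lemma relpow_Restr_small:
  fixes E :: "('a \<times> 'a) set"
  assumes "(u, v) \<in> E ^^ n"
  shows "\<exists>S. finite S \<and> card S \<le> n + 1 \<and> (u, v) \<in> (Restr E S)\<^sup>*"
proof -
  have "\<exists>S. finite S \<and> card S \<le> n + 1 \<and> v \<in> S \<and> (u, v) \<in> (Restr E S)\<^sup>*"
    using assms
  proof (induction n arbitrary: v)
    case 0
    then show ?case by (intro exI[of _ "{v}"]) auto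
  next
    case (Suc n)
    then obtain w where w: "(u, w) \<in> E ^^ n" "(w, v) \<in> E" by auto
    with Suc.IH obtain S where S: "finite S" "card S \<le> n + 1" "w \<in> S" "(u, w) \<in> (Restr E S)\<^sup>*" by blast
    have "(u, w) \<in> (Restr E (insert v S))\<^sup>*"
      using S(4) by (rule rtrancl_mono[THEN subsetD, rotated]) auto
    then have "(u, v) \<in> (Restr E (insert v S))\<^sup>*" using w(2) S(3) by (auto intro: rtrancl_into_rtrancl)
    then show ?case using S by (intro exI[of _ "insert v S"]) (auto simp: card_insert_if)
  qed
  then show ?thesis by blast
qed

lemma path_ends_imp_relpow:
  assumes "path_ends E (d + 1) u v z y"
  shows "\<exists>n\<le>d + 1. (u, v) \<in> E ^^ n"
proof -
  obtain n where "(u, z) \<in> E" "n < d + 1" "(z, v) \<in> Restr E (- {u}) ^^ n"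
    using assms by (auto simp: path_ends_def)
  moreover have "Restr E (- {u}) \<subseteq> E" by blast
  ultimately have "(u, v) \<in> E ^^ Suc n" by (meson relpow_Suc_I2 relpow_mono_set)
  with \<open>n < d + 1\<close> show ?thesis by (intro exI[of _ "Suc n"]) auto
qed

text \<open>
  The vertices \<open>x i\<close> lie in consecutive blocks of length \<open>m = N * M\<close>, at decreasing offsets
  \<open>(N - 1 - i) * M + f i\<close>; so \<open>x i\<close> and \<open>x j\<close> are at distance exactly \<open>j - i\<close>, with little slack.
\<close>
lemma power_path_needs_many_trees:
  fixes k n :: nat
  defines "N \<equiv> 4 ^ k + 1"
  defines "M \<equiv> k * N ^ 3 * (N + 3) + 1"
  assumes n: "N ^ 2 * M \<le> n"
    and fin: "finite \<T>"
    and span: "collectively_plus_one_spans \<T> (power_path n (N * M))"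
  shows "k < card \<T>"
proof (rule ccontr)
  assume "\<not> k < card \<T>"
  then have card_T: "card \<T> \<le> k" by simp
  define m where "m = N * M"
  define G where "G = power_path n m"
  define P where "P f i = i * m + ((N - 1 - i) * M + f i)" for f :: "nat \<Rightarrow> nat" and i
  define short where "short T u v S \<longleftrightarrow> finite S \<and> card S \<le> N + 3 \<and> (u, v) \<in> (Restr (parcs T) S)\<^sup>*"
    for T :: "nat pair_pre_digraph" and u v S
  \<comment> \<open>A route is chosen from T and its two ends only, before any \<open>x j\<close> in
    between is looked at. The default {} keeps the size bound valid for all arguments, as the union
    bound needs it for every offset function.\<close>
  define route where "route T u v = (if Ex (short T u v) then SOME S. short T u v S else {})" for T u v
  have route_short: "short T u v (route T u v)" if "short T u v S" for T u v S
    using someI[of "short T u v", OF that] that by (auto simp: route_def)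
  have "finite (route T u v) \<and> card (route T u v) \<le> N + 3" for T u v
  proof (cases "Ex (short T u v)")
    case True
    then obtain S where "short T u v S" ..
    from route_short[OF this] show ?thesis unfolding short_def by blast
  next
    case False
    then show ?thesis unfolding route_def if_not_P[OF False] by simp
  qed
  then have route: "finite (route T u v)" "card (route T u v) \<le> N + 3" for T u v by blast+
  define C where "C = \<T> \<times> {(i, j, l). i < j \<and> j < l \<and> l < N}"
  \<comment> \<open>The forbidden offsets for \<open>x j\<close>. The ends \<open>P f i\<close> and
    \<open>P f l\<close> do not involve \<open>f j\<close>, and v determines the position, so there
    are at most as many as route vertices.\<close>
  define B where "B c f = (case c of (T, i, j, l) \<Rightarrow> {v. P (f(j := v)) j \<in> route T (P f i) (P f l)})" for c f
  have "\<exists>f \<in> {..<N} \<rightarrow> {..<M}. \<forall>c\<in>C. f (fst (snd (snd c))) \<notin> B c f"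
  proof (rule exists_function_avoiding[where s = "N + 3"])
    have sub: "{(i, j, l). i < j \<and> j < l \<and> l < N} \<subseteq> {..<N} \<times> {..<N} \<times> {..<N}" by auto
    have "card {(i, j, l). i < j \<and> j < l \<and> l < N} \<le> card ({..<N} \<times> {..<N} \<times> {..<N})"
      using sub by (intro card_mono) auto
    then have "card C \<le> k * N ^ 3"
      unfolding C_def card_cartesian_product using card_T
      by (intro mult_le_mono) (auto simp: card_cartesian_product power3_eq_cube)
    \<comment> \<open>M was chosen for this: at most \<open>k * N ^ 3\<close> constraints, each
      forbidding at most \<open>N + 3\<close> offsets.\<close>
    then show "card C * (N + 3) < M" unfolding M_def by (simp add: le_imp_less_Suc)
    show "finite C" unfolding C_def using fin finite_subset[OF sub] by simp
    fix c f assume c: "c \<in> C"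
    obtain T i j l where [simp]: "c = (T, i, j, l)" by (cases c)
    have ord: "i < j" "j < l" "l < N" using c by (auto simp: C_def)
    show "fst (snd (snd c)) \<in> {..<N}" using ord by simp
    show "B c (f(fst (snd (snd c)) := v)) = B c f" for v
      using ord by (simp add: B_def P_def)
    have inj: "inj (\<lambda>v. P (f(j := v)) j)" by (auto simp: inj_def P_def)
    have B: "B c f = (\<lambda>v. P (f(j := v)) j) -` route T (P f i) (P f l)" by (auto simp: B_def)
    show "finite (B c f)" unfolding B using inj route(1) by (simp add: finite_vimageI)
    show "card (B c f) \<le> N + 3"
      unfolding B using card_vimage_inj_on_le[OF inj route(1), of T "P f i" "P f l"]
        route(2)[of T "P f i" "P f l"] by simp
  qed simp
  then obtain f where f: "\<And>i. i < N \<Longrightarrow> f i < M" "\<And>c. c \<in> C \<Longrightarrow> f (fst (snd (snd c))) \<notin> B c f"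
    by (auto simp: Pi_iff)
  define r where "r i = (N - 1 - i) * M + f i" for i
  define x where "x i = i * m + r i" for i
  have off: "x j \<notin> route T (x i) (x l)" if "T \<in> \<T>" "i < j" "j < l" "l < N" for T i j l
    using f(2)[of "(T, i, j, l)"] that by (simp add: C_def B_def P_def x_def r_def)
  have r_less: "r i < m" if "i < N" for i
  proof -
    have "r i < (N - 1 - i) * M + M" using f(1)[OF that] by (simp add: r_def)
    also have "\<dots> = (N - i) * M" using that by (metis Suc_diff_Suc add.commute diff_Suc_eq_diff_pred mult_Suc)
    also have "\<dots> \<le> m" by (simp add: m_def)
    finally show ?thesis .
  qed
  \<comment> \<open>The bases \<open>(N - 1 - i) * M\<close> drop by M at each index and f adds less
    than M. Decreasing offsets make \<open>x j \<le> x i + m * (j - i)\<close>, so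
    \<open>j - i\<close> edges suffice in G.\<close>
  have r_mono: "r j < r i" if "i < j" "j < N" for i j
  proof -
    have "r j < (N - j) * M"
      using f(1)[OF that(2)] that(2)
      by (metis Suc_diff_Suc add.commute add_less_cancel_left diff_Suc_eq_diff_pred mult_Suc r_def)
    also have "\<dots> \<le> (N - 1 - i) * M" using that by (intro mult_le_mono1) linarith
    finally show ?thesis by (simp add: r_def)
  qed
  have x_vert: "x i \<in> pverts G" if "i < N" for i
  proof -
    have "x i < (i + 1) * m" using r_less[OF that] by (simp add: x_def)
    also have "\<dots> \<le> N * m" using that by (intro mult_le_mono1) simp
    also have "\<dots> \<le> n" using n by (simp add: m_def power2_eq_square mult.assoc)
    finally show ?thesis by (simp add: G_def power_path_def)
  qed
  have x_mono: "x i < x j" if "i < j" "j < N" for i j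
  proof -
    have "(i + 1) * m \<le> j * m" using that by (intro mult_le_mono1) simp
    then show ?thesis using r_less[of i] that by (simp add: x_def)
  qed
  have dist: "graph_dist G (x i) (x j) \<le> ereal (real (j - i))" if ij: "i < j" "j < N" for i j
  proof -
    have "j * m = i * m + m * (j - i)" using ij by (metis add_mult_distrib le_add_diff_inverse less_imp_le mult.commute)
    then have "x j \<le> x i + m * (j - i)" using r_mono[OF ij] by (simp add: x_def)
    then obtain k' where k': "k' \<le> j - i" "(x i, x j) \<in> parcs G ^^ k'"
      using power_path_relpow[of "x i" "x j" m "j - i" n] x_mono[OF ij] x_vert[OF ij(2)]
      by (auto simp: G_def power_path_def)
    interpret G: pair_graph G unfolding G_def by (rule pair_graph_power_path)
    have "graph_dist G (x i) (x j) \<le> ereal (real k')"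
      using k' x_vert[of i] ij by (intro G.graph_dist_le) auto
    then show ?thesis using k'(1) by (meson ereal_less_eq(3) of_nat_mono order_trans)
  qed
  have tree: "undirected_tree T" "simple_connected_graph T" "pair_graph T" "pverts T = pverts G" "parcs T \<subseteq> parcs G"
    if "T \<in> \<T>" for T
    using span that
    by (auto simp: collectively_plus_one_spans_def undirected_spanning_tree_def undirected_tree_def
        simple_connected_graph_def spanning_def subgraph_def G_def m_def)
  have served: "\<exists>T\<in>\<T>. \<exists>z y. path_ends (parcs T) (j - i + 1) (x i) (x j) z y" if ij: "i < j" "j < N" for i j
  proof -
    have v: "x i \<in> pverts G" "x j \<in> pverts G" using x_vert ij by auto
    obtain T where T: "T \<in> \<T>" "graph_dist T (x i) (x j) \<le> graph_dist G (x i) (x j) + 1"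
      using span v unfolding collectively_plus_one_spans_def G_def m_def by blast
    have le: "graph_dist T (x i) (x j) \<le> ereal (real (j - i)) + 1"
      using T(2) dist[OF ij] by (meson add_right_mono order_trans)
    obtain p where p: "pre_digraph.apath T (x i) p (x j)"
      "graph_dist T (x i) (x j) = ereal (real (length p))"
      using graph_dist_apath[OF tree(2)[OF T(1)]] tree(4)[OF T(1)] v by metis
    interpret pair_graph T using tree(3)[OF T(1)] .
    have "length p \<le> j - i + 1" using le p(2) by (simp add: one_ereal_def)
    moreover have "x i \<noteq> x j" using x_mono[OF ij] by simp
    ultimately show ?thesis using apath_imp_path_ends[OF p(1)] T(1) by blast
  qed
  have "\<exists>c :: nat \<Rightarrow> nat. (\<forall>i. c i < 4) \<and>
      (\<forall>i j z y. i < j \<longrightarrow> j < N \<longrightarrow> path_ends (parcs T) (j - i + 1) (x i) (x j) z y \<longrightarrow> c i \<noteq> c j)"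
    if T: "T \<in> \<T>" for T
  proof -
    interpret pair_graph T using tree(3)[OF T] .
    show ?thesis
    proof (rule tree_served_pairs_4_colourable[of "parcs T" m x r N])
      show "sym (parcs T)" by (auto simp: sym_def intro: arcs_symmetric)
      show "(a, a) \<notin> parcs T" for a using no_loops' by blast
      show "b \<le> a + m" if "(a, b) \<in> parcs T" for a b
        using that tree(5)[OF T] by (auto simp: G_def power_path_def)
      show "y = z" if "(v, y) \<in> parcs T" "(v, z) \<in> parcs T" "(y, z) \<in> (Restr (parcs T) (- {v}))\<^sup>*" for v y z
        using undirected_treeD[OF tree(1)[OF T]] that by blast
      show "x i = i * m + r i" for i by (simp add: x_def)
      show "r i < m" if "i < N" for i using r_less[OF that] .
      fix i j l z y z' y'
      assume *: "i < j" "j < l" "l < N" "path_ends (parcs T) (j - i + 1) (x i) (x j) z y"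
        "path_ends (parcs T) (l - j + 1) (x j) (x l) z' y'"
      obtain a b where ab: "a \<le> j - i + 1" "(x i, x j) \<in> parcs T ^^ a" "b \<le> l - j + 1" "(x j, x l) \<in> parcs T ^^ b"
        using path_ends_imp_relpow[OF *(4)] path_ends_imp_relpow[OF *(5)] by blast
      \<comment> \<open>This walk through \<open>x j\<close> only shows that some short route
        exists. The route fixed for \<open>x i\<close> and \<open>x l\<close> is then a genuine one,
        and by genericity it misses \<open>x j\<close>. The walk has at most
        \<open>l - i + 2\<close> edges, so \<open>N + 3\<close> covers its vertices.\<close>
      then have "(x i, x l) \<in> parcs T ^^ (a + b)" by (auto simp: relpow_add)
      from relpow_Restr_small[OF this]
      obtain S where "finite S" "card S \<le> a + b + 1" "(x i, x l) \<in> (Restr (parcs T) S)\<^sup>*"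
        by blast
      moreover have "a + b + 1 \<le> N + 3" using ab * by linarith
      ultimately have "short T (x i) (x l) S" by (simp add: short_def)
      from route_short[OF this]
      have "(x i, x l) \<in> (Restr (parcs T) (route T (x i) (x l)))\<^sup>*" by (simp add: short_def)
      moreover have "Restr (parcs T) (route T (x i) (x l)) \<subseteq> Restr (parcs T) (- {x j})"
        using off[OF T *(1,2,3)] by auto
      ultimately show "(x i, x l) \<in> (Restr (parcs T) (- {x j}))\<^sup>*" by (meson rtrancl_mono subsetD)
    qed blast
  qed
  then obtain c :: "nat pair_pre_digraph \<Rightarrow> nat \<Rightarrow> nat" where c: "\<And>T i. T \<in> \<T> \<Longrightarrow> c T i < 4"
    "\<And>T i j z y. T \<in> \<T> \<Longrightarrow> i < j \<Longrightarrow> j < N \<Longrightarrow> path_ends (parcs T) (j - i + 1) (x i) (x j) z y \<Longrightarrow> c T i \<noteq> c T j"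
    by metis
  \<comment> \<open>The product of the colourings, with at most \<open>4 ^ k < N\<close> values: two
    indices agree in every tree, yet some tree serves their pair.\<close>
  define col where "col i = (\<lambda>T\<in>\<T>. c T i)" for i
  have "card (PiE \<T> (\<lambda>_. {..<4::nat})) = 4 ^ card \<T>" using fin by (simp add: card_PiE)
  also have "\<dots> \<le> 4 ^ k" using card_T by (intro power_increasing) auto
  also have "\<dots> < card {..<N}" by (simp add: N_def)
  finally have "card (PiE \<T> (\<lambda>_. {..<4::nat})) < card {..<N}" .
  moreover have "card (col ` {..<N}) \<le> card (PiE \<T> (\<lambda>_. {..<4::nat}))"
    using c(1) fin by (intro card_mono finite_PiE) (auto simp: col_def)
  ultimately have "\<not> inj_on col {..<N}" by (metis card_image leD)
  then obtain i j where ij: "i < j" "j < N" "col i = col j"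
    unfolding inj_on_def by (metis lessThan_iff linorder_neqE_nat)
  then obtain T z y where T: "T \<in> \<T>" "path_ends (parcs T) (j - i + 1) (x i) (x j) z y"
    using served by blast
  have "c T i = c T j" using fun_cong[OF ij(3), of T] T(1) by (simp add: col_def)
  then show False using c(2)[OF T(1) ij(1,2) T(2)] by simp
qed

section \<open>Choice of parameters and asymptotics\<close>

text \<open>The exponent comes from \<open>N \<le> 2 ^ (2 * k + 1)\<close> and
  \<open>M \<le> 4 * N ^ 5\<close>, so that \<open>N ^ 2 * M \<le> 4 * N ^ 7\<close>.\<close>

lemma max_plus_one_tree_number_gt:
  assumes "2 ^ (14 * k + 9) \<le> n"
  shows "k < max_plus_one_tree_number n"
proof -
  define N :: nat where "N = 4 ^ k + 1"
  define M where "M = k * N ^ 3 * (N + 3) + 1"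
  have N: "2 \<le> N" "k \<le> N" "N \<le> 2 ^ (2 * k + 1)"
  proof -
    have "k < 4 ^ k" using less_exp[of k] power_mono[of 2 "4::nat" k] by linarith
    then show "k \<le> N" by (simp add: N_def)
    have "(1::nat) \<le> 4 ^ k" by simp
    then show "2 \<le> N" "N \<le> 2 ^ (2 * k + 1)" by (simp_all add: N_def power_mult)
  qed
  have "k * N ^ 3 * (N + 3) \<le> N * N ^ 3 * (3 * N)"
    using N by (intro mult_le_mono) auto
  also have "\<dots> = 3 * N ^ 5" by (simp add: eval_nat_numeral algebra_simps)
  finally have "M \<le> 3 * N ^ 5 + 1" by (simp add: M_def)
  also have "\<dots> \<le> 4 * N ^ 5" using N(1) by simp
  finally have "N ^ 2 * M \<le> N ^ 2 * (4 * N ^ 5)" by simp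
  also have "\<dots> = 2 ^ 2 * N ^ 7" by (simp add: eval_nat_numeral algebra_simps)
  also have "\<dots> \<le> 2 ^ 2 * (2 ^ (2 * k + 1)) ^ 7" using N(3) by (intro mult_le_mono power_mono) auto
  also have "\<dots> = 2 ^ (2 + (2 * k + 1) * 7)" by (simp only: power_add power_mult)
  also have "2 + (2 * k + 1) * 7 = 14 * k + 9" by simp
  finally have n: "N ^ 2 * M \<le> n" using assms by simp
  have pos: "0 < n" using assms by (rule less_le_trans[rotated]) simp
  have pos': "0 < N * M" by (simp add: N_def M_def)
  define G where "G = power_path n (N * M)"
  have G: "unit_interval_graph G" "card (pverts G) = n"
    using unit_interval_power_path[OF pos pos'] by (auto simp: G_def power_path_def)
  obtain \<T> where "finite \<T>" "card \<T> = plus_one_tree_number G" "collectively_plus_one_spans \<T> G"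
    using plus_one_tree_number_witness G(1) unfolding unit_interval_graph_def by blast
  then have "k < plus_one_tree_number G"
    using power_path_needs_many_trees[of k n \<T>] n by (auto simp: G_def N_def M_def)
  with plus_one_tree_number_le_max[OF G(1)] G(2) show ?thesis by simp
qed

theorem theorem3:
  shows "(\<lambda>n. real (max_plus_one_tree_number n)) \<in> \<Omega>(\<lambda>n. root 3 (ln (real n)))"
proof (rule landau_omega.bigI[of "1 / 23"])
  have "root 3 (ln (real n)) / 23 \<le> real (max_plus_one_tree_number n)" if n: "2 ^ 9 \<le> n" for n
  proof -
    have "9 \<le> log 2 (real n)" 
      using n by (simp add: le_log_iff powr_realpow) 
    \<comment> \<open>The largest k with \<open>14 * k + 9 \<le> log 2 n\<close>;
      \<open>n \<ge> 2 ^ 9\<close> makes it nonnegative before \<open>nat\<close> is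
      applied.\<close>
    define k where "k = nat \<lfloor>(log 2 (real n) - 9) / 14\<rfloor>"
    have "real k = of_int \<lfloor>(log 2 (real n) - 9) / 14\<rfloor>"
      using \<open>9 \<le> log 2 (real n)\<close> by (simp add: k_def)
    then have k: "real k \<le> (log 2 (real n) - 9) / 14" "(log 2 (real n) - 9) / 14 < real k + 1"
      by linarith+
    have "2 powr real (14 * k + 9) \<le> real n"
      using k(1) n by (subst le_log_iff[symmetric]) auto
    then have "2 ^ (14 * k + 9) \<le> n"
      by (subst (asm) powr_realpow) (auto simp flip: of_nat_le_iff)
    then have "k + 1 \<le> max_plus_one_tree_number n"
      using max_plus_one_tree_number_gt by (simp add: Suc_le_eq)
    then have "real k + 1 \<le> real (max_plus_one_tree_number n)" by linarith
    \<comment> \<open>Since \<open>log 2 n < 14 * (k + 1) + 9 \<le> 23 * (k + 1)\<close>; this is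
      the source of 1 / 23.\<close>
    moreover have "log 2 (real n) / 23 \<le> real k + 1"
      using k(2) of_nat_0_le_iff[of k, where 'a = real] by (simp add: field_simps)
    \<comment> \<open>The bound obtained is linear in ln n, which dominates its cube root as soon as
      ln n is at least 1.\<close>
    moreover have "root 3 (ln (real n)) \<le> log 2 (real n)"
    proof -
      have "3 \<le> real n" using n by simp
      then have "exp 1 \<le> real n" using exp_le by linarith
      then have 1: "1 \<le> ln (real n)" using n by (simp add: ln_ge_iff)
      then have "root 3 (ln (real n)) \<le> root 3 (ln (real n) ^ 3)"
        by (intro real_root_le_mono self_le_power) auto
      also have "\<dots> = ln (real n)" using 1 by (simp add: real_root_power_cancel)
      also have "\<dots> \<le> log 2 (real n)"
        using 1 ln_2_less_1 by (simp add: log_def field_simps)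
      finally show ?thesis .
    qed
    ultimately show ?thesis by linarith
  qed
  moreover have "0 \<le> root 3 (ln (real n))" if "2 ^ 9 \<le> n" for n
    using that by simp
  ultimately show "\<forall>\<^sub>F n in at_top. norm (real (max_plus_one_tree_number n)) \<ge> 1 / 23 * norm (root 3 (ln (real n)))"
    by (intro eventually_at_top_linorderI[of "2 ^ 9"]) auto
qed simp

end
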